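(* Let $M$ and $N$ be atomic JBW$^*$-triples, and let $\Phi: \mathcal{U}_{min}(M)\to \mathcal{U}_{min}(N)$ be a bijection preserving triple transition pseudo-probabilities, that is, $TTP(\Phi(e),\Phi(v)) = TTP(e,v)$ for all $e,v\in \mathcal{U}_{min}(M)$. Then $\Phi$ preserves orthogonality in both directions, that is, for all $e,v\in \mathcal{U}_{min}(M)$ one has $e\perp v$ if and only if $\Phi(e)\perp\Phi(v)$.
   Context: A JB$^*$-triple is a complex Banach space $E$ with a continuous triple product $\{\cdot,\cdot,\cdot\}: E\times E\times E\to E$, symmetric and bilinear in the first and third variables and conjugate-linear in the middle one, such that, writing $L(a,b)x=\{a,b,x\}$: (a) $L(a,b)L(x,y)=L(x,y)L(a,b)+L(L(a,b)x,y)-L(x,L(b,a)y)$ for all $a,b,x,y\in E$; (b) $L(a,a)$ is a hermitian operator on the Banach space $E$ with non-negative spectrum for every $a\in E$; (c) $\|\{a,a,a\}\|=\|a\|^3$ for every $a\in E$. A tripotent is an element $e\in E$ with $\{e,e,e\}=e$; $\mathcal{U}(E)$ denotes the set of tripotents. For a tripotent $e$, $E=E_0(e)\oplus E_1(e)\oplus E_2(e)$ with $E_k(e)=\{x\in E: L(e,e)x=\frac{k}{2}x\}$ (Peirce decomposition); $P_k(e)$ is the corresponding projection onto $E_k(e)$. A non-zero tripotent $e$ is minimal if $E_2(e)=\mathbb{C}e$; $\mathcal{U}_{min}(E)$ denotes the set of minimal tripotents. Tripotents $e,u$ are orthogonal, $e\perp u$, if $\{e,e,u\}=0$ (equivalently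 $e\in E_0(u)$; equivalently $u\in E_0(e)$). A JBW$^*$-triple is a JB$^*$-triple which is a dual Banach space; it has a unique isometric predual $M_*$ and its triple product is separately weak$^*$ continuous. It is atomic if it coincides with the weak$^*$-closure of the linear span of its minimal tripotents (equivalently, it is an $\ell_\infty$-sum of Cartan factors). For each minimal tripotent $e$ in a JBW$^*$-triple $M$ there is a unique extreme point $\varphi_e$ of the closed unit ball of $M_*$ with $\varphi_e(e)=1$, and $P_2(e)(x)=\varphi_e(x)e$ for all $x\in M$. For $e,v\in\mathcal{U}_{min}(M)$ the triple transition pseudo-probability from $e$ to $v$ is the complex number $TTP(e,v)=\varphi_v(e)$. *)

theory Defs
  imports "HOL-Analysis.Analysis" "HOL-Library.Nonpos_Ints"
begin

section \<open>Complex Banach spaces\<close>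

class complex_vector = real_vector +
  fixes scaleC :: "complex \<Rightarrow> 'a \<Rightarrow> 'a"  (infixr \<open>*\<^sub>C\<close> 75)
  assumes scaleC_add_right: "a *\<^sub>C (x + y) = a *\<^sub>C x + a *\<^sub>C y"
    and scaleC_add_left: "(a + b) *\<^sub>C x = a *\<^sub>C x + b *\<^sub>C x"
    and scaleC_scaleC: "a *\<^sub>C (b *\<^sub>C x) = (a * b) *\<^sub>C x"
    and scaleC_one: "1 *\<^sub>C x = x"
    and scaleC_of_real: "complex_of_real r *\<^sub>C x = r *\<^sub>R x"

interpretation complex_vector: vector_space "scaleC :: complex \<Rightarrow> 'a \<Rightarrow> 'a::complex_vector"
  by standard (simp_all add: scaleC_add_right scaleC_add_left scaleC_scaleC scaleC_one)

class complex_normed_vector = complex_vector + real_normed_vector +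
  assumes norm_scaleC: "norm (a *\<^sub>C x) = cmod a * norm x"

class complex_banach = complex_normed_vector + complete_space

subclass (in complex_banach) banach ..

instantiation complex :: complex_banach
begin

definition scaleC_complex :: "complex \<Rightarrow> complex \<Rightarrow> complex"
  where "scaleC_complex a x = a * x"

instance
  by standard (simp_all add: scaleC_complex_def algebra_simps norm_mult scaleR_conv_of_real)

end

definition bounded_clinear :: "('a::complex_normed_vector \<Rightarrow> 'b::complex_normed_vector) \<Rightarrow> bool"
  where "bounded_clinear f \<longleftrightarrow> bounded_linear f \<and> (\<forall>c x. f (c *\<^sub>C x) = c *\<^sub>C f x)"

definition operator_exp :: "('a::complex_banach \<Rightarrow> 'a) \<Rightarrow> 'a \<Rightarrow> 'a"
  where "operator_exp T x = (\<Sum>n. (T ^^ n) x /\<^sub>R fact n)"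

text \<open>
  A bounded operator \<open>T\<close> is hermitian if \<open>exp (i t T)\<close> has norm 1 for all real \<open>t\<close>. As the inverse of
  \<open>exp (i t T)\<close> is \<open>exp (- i t T)\<close>, this says that all these exponentials are isometries, a form
  which also makes sense on the zero space.
\<close>

definition hermitian :: "('a::complex_banach \<Rightarrow> 'a) \<Rightarrow> bool"
  where "hermitian T \<longleftrightarrow> bounded_clinear T \<and>
    (\<forall>(t::real) x. norm (operator_exp (\<lambda>y. (\<i> * complex_of_real t) *\<^sub>C T y) x) = norm x)"

definition spectrum :: "('a::complex_banach \<Rightarrow> 'a) \<Rightarrow> complex set"
  where "spectrum T = {z. \<not> (\<exists>S. bounded_clinear S \<and>
    (\<forall>x. S (z *\<^sub>C x - T x) = x) \<and> (\<forall>x. z *\<^sub>C S x - T (S x) = x))}"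


section \<open>JB*-triples, tripotents and Peirce spaces\<close>

text \<open>The operator \<open>L a b\<close> of the literature is \<open>T a b\<close>, where \<open>T\<close> is the triple product.\<close>

locale jb_star_triple =
  fixes T :: "'a::complex_banach \<Rightarrow> 'a \<Rightarrow> 'a \<Rightarrow> 'a"
  assumes continuous: "continuous_on UNIV (\<lambda>(x, y, z). T x y z)"
    and commute: "T x y z = T z y x"
    and add_left: "T (x + x') y z = T x y z + T x' y z"
    and scaleC_left: "T (c *\<^sub>C x) y z = c *\<^sub>C T x y z"
    and add_middle: "T x (y + y') z = T x y z + T x y' z"
    and scaleC_middle: "T x (c *\<^sub>C y) z = cnj c *\<^sub>C T x y z"
    and jordan_identity:
      "T a b (T x y z) = T x y (T a b z) + T (T a b x) y z - T x (T b a y) z"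
    and hermitian: "hermitian (T a a)"
    and spectrum_nonneg: "spectrum (T a a) \<subseteq> \<real>\<^sub>\<ge>\<^sub>0"
    and norm_cube: "norm (T a a a) = norm a ^ 3"

definition tripotents :: "('a::complex_banach \<Rightarrow> 'a \<Rightarrow> 'a \<Rightarrow> 'a) \<Rightarrow> 'a set"
  where "tripotents T = {e. T e e e = e}"

definition peirce_space :: "('a::complex_banach \<Rightarrow> 'a \<Rightarrow> 'a \<Rightarrow> 'a) \<Rightarrow> nat \<Rightarrow> 'a \<Rightarrow> 'a set"
  where "peirce_space T k e = {x. T e e x = (of_nat k / 2) *\<^sub>C x}"

definition minimal_tripotents :: "('a::complex_banach \<Rightarrow> 'a \<Rightarrow> 'a \<Rightarrow> 'a) \<Rightarrow> 'a set"
  where "minimal_tripotents T =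
    {e \<in> tripotents T. e \<noteq> 0 \<and> peirce_space T 2 e = range (\<lambda>c. c *\<^sub>C e)}"

definition orthogonal_tripotents ::
    "('a::complex_banach \<Rightarrow> 'a \<Rightarrow> 'a \<Rightarrow> 'a) \<Rightarrow> 'a \<Rightarrow> 'a \<Rightarrow> bool"
  where "orthogonal_tripotents T e u \<longleftrightarrow> T e e u = 0"


section \<open>JBW*-triples\<close>

text \<open>
  The predual is a complex Banach space \<open>'p\<close>, and \<open>J\<close> is an isometric isomorphism of the triple
  onto the dual of \<open>'p\<close>. The dual consists of the complex-linear elements of
  \<open>'p \<Rightarrow>\<^sub>L complex\<close>, whose norm is the operator norm. Through \<open>J\<close>, an element \<open>p\<close> of the predual
  acts on the triple as the functional \<open>\<lambda>x. J x p\<close>.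
\<close>

locale jbw_star_triple = jb_star_triple T
  for T :: "'a::complex_banach \<Rightarrow> 'a \<Rightarrow> 'a \<Rightarrow> 'a" +
  fixes J :: "'a \<Rightarrow> 'p::complex_banach \<Rightarrow>\<^sub>L complex"
  assumes J_add: "J (x + y) = J x + J y"
    and J_scaleC: "blinfun_apply (J (c *\<^sub>C x)) p = c * blinfun_apply (J x) p"
    and J_isometric: "norm (J x) = norm x"
    and J_onto_dual: "range J = {f. bounded_clinear (blinfun_apply f)}"

definition weak_star_topology :: "('a \<Rightarrow> 'p::complex_banach \<Rightarrow>\<^sub>L complex) \<Rightarrow> 'a topology"
  where "weak_star_topology J =
    topology_generated_by {(\<lambda>x. blinfun_apply (J x) p) -` U | p U. open U}"

locale atomic_jbw_star_triple = jbw_star_triple T J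
  for T :: "'a::complex_banach \<Rightarrow> 'a \<Rightarrow> 'a \<Rightarrow> 'a"
    and J :: "'a \<Rightarrow> 'p::complex_banach \<Rightarrow>\<^sub>L complex" +
  assumes atomic:
    "weak_star_topology J closure_of complex_vector.span (minimal_tripotents T) = UNIV"

text \<open>
  The extreme point of the closed unit ball of the predual supporting a minimal tripotent \<open>e\<close>;
  its existence and uniqueness are theorems about JBW*-triples.
\<close>

definition support_functional ::
    "('a \<Rightarrow> 'p::complex_banach \<Rightarrow>\<^sub>L complex) \<Rightarrow> 'a \<Rightarrow> 'p"
  where "support_functional J e =
    (THE p. p extreme_point_of cball 0 1 \<and> blinfun_apply (J e) p = 1)"

definition TTP :: "('a \<Rightarrow> 'p::complex_banach \<Rightarrow>\<^sub>L complex) \<Rightarrow> 'a \<Rightarrow> 'a \<Rightarrow> complex"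
  where "TTP J e v = blinfun_apply (J e) (support_functional J v)"

end

theory Submission
  imports Defs
begin

text \<open>
  Below, \<open>{x,y,z}\<close> denotes \<open>T x y z\<close>. Orthogonality of minimal tripotents can be read off from
  transition pseudo-probabilities alone: \<open>e\<close> and \<open>v\<close> are orthogonal if and only if
  \<open>cmod (TTP e w) + cmod (TTP v w) \<le> 1\<close> for every minimal tripotent \<open>w\<close>
  (lemma \<open>orthogonal_iff_TTP\<close>). A bijection of the minimal tripotents that
  preserves \<open>TTP\<close> preserves this criterion in both directions.

  If \<open>e\<close> and \<open>v\<close> are orthogonal and \<open>a\<close>, \<open>b\<close> have modulus 1, then \<open>a e + b v\<close> is a tripotent, hence of
  norm at most 1. The support functional of \<open>w\<close> lies in the unit ball, and a choice of the phases
  \<open>a\<close>, \<open>b\<close> turns its value on \<open>a e + b v\<close> into the sum of the two moduli.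

  Conversely, suppose that the criterion holds. Taking \<open>w = v\<close> and \<open>w = e\<close> shows that the two mutual
  transitions vanish, so \<open>e = e1 + e0\<close> with \<open>e1\<close>, \<open>e0\<close> in the Peirce 1- and 0-spaces of \<open>v\<close>. If
  \<open>e1 = 0\<close>, then \<open>e\<close> and \<open>v\<close> are orthogonal. If \<open>e1\<close> were not 0, it would be a
  multiple \<open>r u\<close> of a tripotent \<open>u\<close> such that \<open>v\<close>, \<open>u\<close> behave like two
  orthonormal vectors of a Hilbert space: every \<open>w = c v + s u\<close> with \<open>c\<^sup>2 + s\<^sup>2 = 1\<close> is a minimal
  tripotent, with transitions \<open>c\<close> from \<open>v\<close> and \<open>r s\<close> from \<open>e\<close>. As \<open>c + r s\<close> exceeds 1 for a small positive
  angle, the criterion fails (lemma \<open>transition_witness\<close>).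

  It remains to know that a minimal tripotent \<open>w\<close> does have a unique support functional in the predual,
  and that it is the functional \<open>\<phi>\<close> with \<open>{w,x,w} = cnj (\<phi> x) w\<close>. If \<open>{w,y,w} = 0\<close>, the identity
  \<open>norm {a,a,a} = norm a ^ 3\<close> at \<open>a = w + y\<close> yields \<open>norm (w + y) \<le> 1 + C (norm y)\<^sup>2\<close>
  (lemma \<open>norm_near_tripotent\<close>). So a functional in the unit ball whose value at \<open>w\<close> is nearly 1 is
  nearly 0 at \<open>y\<close>, and is therefore close to \<open>\<phi>\<close> in norm
  (lemma \<open>functional_near_minimal\<close>). Elements of the predual that almost norm \<open>w\<close> thus form
  Cauchy sequences, and the limit is the required functional (lemma \<open>support_exists\<close>). Measuring
  distances in the predual by elements of the triple needs the complex Hahn-Banach theorem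
  (lemma \<open>norming_functional\<close>).
\<close>

section \<open>The complex Hahn-Banach theorem\<close>

definition sublinear :: "('a::real_vector \<Rightarrow> real) \<Rightarrow> bool"
  where "sublinear q \<longleftrightarrow>
    (\<forall>x y. q (x + y) \<le> q x + q y) \<and> (\<forall>c x. 0 \<le> c \<longrightarrow> q (c *\<^sub>R x) = c * q x)"

lemma sublinear_add: "sublinear q \<Longrightarrow> q (x + y) \<le> q x + q y"
  and sublinear_scale: "sublinear q \<Longrightarrow> 0 \<le> c \<Longrightarrow> q (c *\<^sub>R x) = c * q x"
  by (auto simp: sublinear_def)

lemma sublinear_zero: "sublinear q \<Longrightarrow> q 0 = 0"
  using sublinear_scale[of q 0 0] by simp

lemma sublinear_minus: "sublinear q \<Longrightarrow> - q (- x) \<le> q x"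
  using sublinear_add[of q x "- x"] sublinear_zero[of q] by simp

lemma sublinear_norm: "sublinear (norm :: 'a::real_normed_vector \<Rightarrow> real)"
  by (auto simp: sublinear_def norm_triangle_ineq)

text \<open>
  The infimum of \<open>q (x + t y) - t q y\<close> over \<open>t \<ge> 0\<close> is the largest sublinear functional of \<open>x\<close> with
  these properties. It serves twice: a sublinear functional that
  cannot be lowered in this way is odd, hence linear; and a linear functional below the tilted norm
  attains its norm at \<open>y\<close>.
\<close>

lemma sublinear_tilt:
  fixes q :: "'a::real_vector \<Rightarrow> real"
  assumes q: "sublinear q"
  obtains r where "sublinear r" "\<And>x. r x \<le> q x" "r (- y) \<le> - q y"
proof
  define h where "h x t = q (x + t *\<^sub>R y) - t * q y" for x t
  define r where "r x = (INF t\<in>{0..}. h x t)" for x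
  have below: "- q (- x) \<le> h x t" if "0 \<le> t" for x t
    using sublinear_add[OF q, of "x + t *\<^sub>R y" "- x"] sublinear_scale[OF q that, of y]
    by (simp add: h_def)
  have bdd: "bdd_below (h x ` {0..})" for x
    using below by (intro bdd_belowI2[of _ "- q (- x)"]) simp
  have r_le: "r x \<le> h x t" if "0 \<le> t" for x t
    unfolding r_def using that by (intro cINF_lower bdd) simp
  have le_r: "m \<le> r x" if "\<And>t. 0 \<le> t \<Longrightarrow> m \<le> h x t" for m x
    unfolding r_def using that by (intro cINF_greatest) auto
  show "r x \<le> q x" for x
    using r_le[of 0 x] by (simp add: h_def)
  show "r (- y) \<le> - q y"
    using r_le[of 1 "- y"] sublinear_zero[OF q] by (simp add: h_def)
  have add: "r (x + x') \<le> r x + r x'" for x x'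
  proof -
    have "r (x + x') - h x' t' \<le> h x t" if "0 \<le> t" "0 \<le> t'" for t t'
    proof -
      have "x + x' + (t + t') *\<^sub>R y = (x + t *\<^sub>R y) + (x' + t' *\<^sub>R y)"
        by (simp add: algebra_simps)
      then have "h (x + x') (t + t') \<le> h x t + h x' t'"
        using sublinear_add[OF q, of "x + t *\<^sub>R y" "x' + t' *\<^sub>R y"]
        by (simp add: h_def algebra_simps)
      then show ?thesis
        using r_le[of "t + t'" "x + x'"] that by simp
    qed
    then have "r (x + x') - r x \<le> h x' t'" if "0 \<le> t'" for t'
      using le_r[of "r (x + x') - h x' t'" x] that by force
    then show ?thesis
      using le_r[of "r (x + x') - r x" x'] by simp
  qed
  have scale_ge: "c * r x \<le> r (c *\<^sub>R x)" if "0 < c" for c x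
  proof (rule le_r)
    fix t :: real
    assume "0 \<le> t"
    have "c *\<^sub>R x + t *\<^sub>R y = c *\<^sub>R (x + (t / c) *\<^sub>R y)"
      using that by (simp add: algebra_simps)
    then have "h (c *\<^sub>R x) t = c * h x (t / c)"
      using that by (simp add: h_def sublinear_scale[OF q] right_diff_distrib)
    then show "c * r x \<le> h (c *\<^sub>R x) t"
      using r_le[of "t / c" x] that \<open>0 \<le> t\<close> by simp
  qed
  have "r (c *\<^sub>R x) = c * r x" if "0 < c" for c x
    using scale_ge[OF that, of x] scale_ge[of "1 / c" "c *\<^sub>R x"] that
    by (simp add: field_simps)
  moreover have "r 0 = 0"
    using le_r[of 0 0] r_le[of 0 0] sublinear_zero[OF q] sublinear_scale[OF q, of _ y]
    by (simp add: h_def)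
  ultimately have "r (c *\<^sub>R x) = c * r x" if "0 \<le> c" for c x
    using that by (cases "c = 0") auto
  with add show "sublinear r"
    by (simp add: sublinear_def)
qed

text \<open>
  A minimal sublinear functional below \<open>p\<close>, which Zorn's lemma provides, is linear. Compared with
  extending functionals from subspaces, this keeps all functions total.
\<close>

lemma sublinear_dominates_linear:
  fixes p :: "'a::real_vector \<Rightarrow> real"
  assumes p: "sublinear p"
  obtains f where "linear f" "\<And>x. f x \<le> p x"
proof -
  define A where "A = {q. sublinear q \<and> (\<forall>x. q x \<le> p x)}"
  define P where "P a b \<longleftrightarrow> (\<forall>x. b x \<le> a x)" for a b :: "'a \<Rightarrow> real"
  have "partial_order_on A (relation_of P A)"
    by (rule partial_order_on_relation_ofI) (auto simp: P_def fun_eq_iff intro: order_trans antisym)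
  moreover have "\<exists>u\<in>A. \<forall>a\<in>C. P a u" if C: "C \<in> Chains (relation_of P A)" for C
  proof (cases "C = {}")
    case True
    then show ?thesis
      using p by (auto simp: A_def)
  next
    case False
    have CA: "q \<in> A" if "q \<in> C" for q
      using C that by (auto simp: Chains_def relation_of_def)
    have total: "P q q' \<or> P q' q" if "q \<in> C" "q' \<in> C" for q q'
      using C that by (auto simp: Chains_def relation_of_def)
    define u where "u x = (INF q\<in>C. q x)" for x
    \<comment> \<open>The pointwise infimum of the chain is finite: no member lies below \<open>- p (- x)\<close> at \<open>x\<close>.\<close>
    have "- p (- x) \<le> q x" if "q \<in> C" for q x
      using CA[OF that] sublinear_minus[of q x] unfolding A_def
      by (smt (verit) mem_Collect_eq)
    then have bdd: "bdd_below ((\<lambda>q. q x) ` C)" for x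
      by (intro bdd_belowI2[of _ "- p (- x)"])
    have u_le: "u x \<le> q x" if "q \<in> C" for q x
      unfolding u_def using that bdd by (intro cINF_lower)
    have le_u: "m \<le> u x" if "\<And>q. q \<in> C \<Longrightarrow> m \<le> q x" for m x
      unfolding u_def using that False by (intro cINF_greatest)
    have "u (x + y) \<le> u x + u y" for x y
    proof -
      have "u (x + y) - q' y \<le> q x" if "q \<in> C" "q' \<in> C" for q q'
      proof -
        have "\<exists>s\<in>C. s x \<le> q x \<and> s y \<le> q' y"
          using total[OF that] that unfolding P_def by (metis order_refl)
        then obtain s where s: "s \<in> C" "s x \<le> q x" "s y \<le> q' y"
          by blast
        have "u (x + y) \<le> s x + s y"
          using u_le[OF s(1), of "x + y"] sublinear_add[of s x y] CA[OF s(1)]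
          by (auto simp: A_def)
        with s show ?thesis by simp
      qed
      then have "u (x + y) - u x \<le> q' y" if "q' \<in> C" for q'
        using le_u[of "u (x + y) - q' y" x] that by force
      then show ?thesis
        using le_u[of "u (x + y) - u x" y] by simp
    qed
    moreover have "u (c *\<^sub>R x) = c * u x" if "0 \<le> c" for c x
    proof -
      have scale: "q (c *\<^sub>R x) = c * q x" if "q \<in> C" for q
        using CA[OF that] \<open>0 \<le> c\<close> by (auto simp: A_def sublinear_scale)
      show ?thesis
      proof (cases "c = 0")
        case True
        obtain q where "q \<in> C"
          using False by blast
        with True show ?thesis
          using scale u_le[of q 0] le_u[of 0 0] by force
      next
        case c: False
        show ?thesis
        proof (rule antisym)
          have "u (c *\<^sub>R x) / c \<le> u x"
            using u_le[of _ "c *\<^sub>R x"] scale c that by (intro le_u) (force simp: field_simps)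
          then show "u (c *\<^sub>R x) \<le> c * u x"
            using c that by (simp add: field_simps)
          show "c * u x \<le> u (c *\<^sub>R x)"
            using u_le[of _ x] scale that by (intro le_u) (metis mult_left_mono)
        qed
      qed
    qed
    moreover have "u x \<le> p x" for x
    proof -
      obtain q where "q \<in> C"
        using False by blast
      then have "q \<in> A" "u x \<le> q x"
        using CA u_le by simp_all
      then show ?thesis
        by (auto simp: A_def intro: order_trans[of _ "q x"])
    qed
    ultimately have "u \<in> A"
      by (simp add: A_def sublinear_def)
    then show ?thesis
      using u_le by (auto simp: P_def)
  qed
  ultimately obtain f where f: "f \<in> A" and minimal: "\<And>q. q \<in> A \<Longrightarrow> P f q \<Longrightarrow> q = f"
    using predicate_Zorn[of A P] by blast
  have sub: "sublinear f" and f_le: "\<And>x. f x \<le> p x"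
    using f by (auto simp: A_def)
  have odd: "f (- y) = - f y" for y
  proof -
    obtain r where r: "sublinear r" "\<And>x. r x \<le> f x" "r (- y) \<le> - f y"
      using sublinear_tilt[OF sub, of y] by blast
    have "r = f"
      using r f_le by (intro minimal) (auto simp: A_def P_def intro: order_trans)
    then show ?thesis
      using r(3) sublinear_minus[OF sub, of y] by simp
  qed
  have "f (x + y) = f x + f y" for x y
    using sublinear_add[OF sub, of x y] sublinear_add[OF sub, of "x + y" "- y"] odd[of y]
    by simp
  moreover have "f (c *\<^sub>R x) = c *\<^sub>R f x" for c x
    using sublinear_scale[OF sub, of c x] sublinear_scale[OF sub, of "- c" x] odd[of "c *\<^sub>R x"]
    by (cases "0 \<le> c") auto
  ultimately have "linear f"
    by (intro linearI)
  then show thesis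
    using f_le that by blast
qed

lemma phase_exists:
  obtains a :: complex where "cmod a = 1" "a * z = complex_of_real (cmod z)"
proof (cases "z = 0")
  case True
  then show thesis using that[of 1] by simp
next
  case False
  have "cnj z / cmod z * z = complex_of_real (cmod z)"
    using False complex_norm_square[of z] by (simp add: field_simps power2_eq_square)
  then show thesis
    using False by (intro that[of "cnj z / cmod z"]) (auto simp: norm_divide)
qed

text \<open>
  A real linear functional \<open>f\<close> is the real part of the complex-linear functional
  \<open>\<lambda>x. f x - \<i> f (\<i> x)\<close>, and rotating \<open>x\<close> by a phase shows that both have the same bound.
\<close>

lemma norming_functional:
  fixes z :: "'a::complex_normed_vector"
  obtains F :: "'a \<Rightarrow>\<^sub>L complex"
  where "bounded_clinear (blinfun_apply F)" "norm F \<le> 1" "Re (F z) = norm z"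
proof -
  obtain r :: "'a \<Rightarrow> real" where r: "sublinear r" "\<And>x. r x \<le> norm x" "r (- z) \<le> - norm z"
    using sublinear_tilt[OF sublinear_norm, of z] by blast
  obtain f where f: "linear f" "\<And>x. f x \<le> r x"
    using sublinear_dominates_linear[OF r(1)] by blast
  have f_le: "f x \<le> norm x" for x
    using f(2) r(2) order_trans by blast
  define F where "F x = Complex (f x) (- f (\<i> *\<^sub>C x))" for x
  have i_scale: "\<i> *\<^sub>C (c *\<^sub>R x) = c *\<^sub>R (\<i> *\<^sub>C x)" for c and x :: 'a
    by (simp add: scaleC_scaleC mult.commute flip: scaleC_of_real)
  have ii: "\<i> *\<^sub>C \<i> *\<^sub>C x = - x" for x :: 'a
    using scaleC_of_real[of "-1" x] by (simp add: scaleC_scaleC)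
  have split: "c *\<^sub>C x = Re c *\<^sub>R x + Im c *\<^sub>R (\<i> *\<^sub>C x)" for c and x :: 'a
  proof -
    have "c *\<^sub>C x = (complex_of_real (Re c) + complex_of_real (Im c) * \<i>) *\<^sub>C x"
      by (simp add: complex_eq mult.commute)
    then show ?thesis
      by (simp only: scaleC_add_left scaleC_of_real flip: scaleC_scaleC)
  qed
  have add: "F (x + y) = F x + F y" for x y
    by (simp add: F_def scaleC_add_right linear_add[OF f(1)] complex_eq_iff)
  have clin: "F (c *\<^sub>C x) = c * F x" for c x
    unfolding split[of c x]
    by (simp add: F_def scaleC_add_right i_scale ii linear_add[OF f(1)] linear_scale[OF f(1)]
        linear_neg[OF f(1)] linear_diff[OF f(1)] complex_eq_iff)
  have bound: "cmod (F x) \<le> norm x" for x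
  proof -
    obtain a where a: "cmod a = 1" "a * F x = complex_of_real (cmod (F x))"
      using phase_exists by blast
    have "cmod (F x) = Re (F (a *\<^sub>C x))"
      by (simp add: clin a(2))
    also have "\<dots> \<le> norm (a *\<^sub>C x)"
      by (simp add: F_def f_le)
    finally show ?thesis
      by (simp add: norm_scaleC a(1))
  qed
  have bl: "bounded_linear F"
  proof (rule bounded_linear_intro)
    show "F (c *\<^sub>R x) = c *\<^sub>R F x" for c x
      using clin[of "complex_of_real c" x] by (simp add: scaleC_of_real scaleR_conv_of_real)
    show "cmod (F x) \<le> norm x * 1" for x
      using bound by simp
  qed (rule add)
  have apply_F: "blinfun_apply (Blinfun F) = F"
    using bl by (rule bounded_linear_Blinfun_apply)
  show thesis
  proof
    show "bounded_clinear (blinfun_apply (Blinfun F))"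
      by (simp add: apply_F bounded_clinear_def bl clin scaleC_complex_def)
    show "norm (Blinfun F) \<le> 1"
      by (rule norm_blinfun_bound) (simp_all add: apply_F bound)
    show "Re (Blinfun F z) = norm z"
      using f(2)[of "- z"] r(3) f_le[of z] linear_neg[OF f(1), of z]
      by (simp add: apply_F F_def)
  qed
qed

section \<open>The triple product as a bounded trilinear map\<close>

context jb_star_triple
begin

lemma add_right: "T x y (z + z') = T x y z + T x y z'"
  using add_left[of z z' y x] by (simp add: commute[of x])

lemma scaleC_right: "T x y (c *\<^sub>C z) = c *\<^sub>C T x y z"
  using scaleC_left[of c z y x] by (simp add: commute[of x])

lemma scaleR_left: "T (r *\<^sub>R x) y z = r *\<^sub>R T x y z"
  using scaleC_left[of "complex_of_real r"] by (simp add: scaleC_of_real)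

lemma scaleR_middle: "T x (r *\<^sub>R y) z = r *\<^sub>R T x y z"
  using scaleC_middle[of x "complex_of_real r"] by (simp add: scaleC_of_real)

lemma scaleR_right: "T x y (r *\<^sub>R z) = r *\<^sub>R T x y z"
  using scaleC_right[of x y "complex_of_real r"] by (simp add: scaleC_of_real)

lemma zero_left: "T 0 y z = 0" and zero_middle: "T x 0 z = 0" and zero_right: "T x y 0 = 0"
  using scaleR_left[of 0 0] scaleR_middle[of x 0 0] scaleR_right[of x y 0 0] by simp_all

lemma minus_left: "T (- x) y z = - T x y z"
  and minus_middle: "T x (- y) z = - T x y z"
  and minus_right: "T x y (- z) = - T x y z"
  using scaleR_left[of "- 1" x] scaleR_middle[of x "- 1" y] scaleR_right[of x y "- 1" z]
  by simp_all

lemma diff_left: "T (x - x') y z = T x y z - T x' y z"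
  and diff_middle: "T x (y - y') z = T x y z - T x y' z"
  and diff_right: "T x y (z - z') = T x y z - T x y z'"
  using add_left[of x "- x'"] add_middle[of x y "- y'"] add_right[of x y z "- z'"]
  by (simp_all add: minus_left minus_middle minus_right)

lemmas trilinear = add_left add_middle add_right scaleC_left scaleC_middle scaleC_right
  scaleR_left scaleR_middle scaleR_right zero_left zero_middle zero_right
  minus_left minus_middle minus_right diff_left diff_middle diff_right

lemma quadratic_expand:
  "T (a *\<^sub>R x + b *\<^sub>R y) z (a *\<^sub>R x + b *\<^sub>R y) =
    (a * a) *\<^sub>R T x z x + (2 * a * b) *\<^sub>R T x z y + (b * b) *\<^sub>R T y z y"
proof -
  have "T y z x = T x z y"
    by (rule commute)
  moreover have "(2 * a * b) *\<^sub>R T x z y = (a * b) *\<^sub>R T x z y + (a * b) *\<^sub>R T x z y"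
    by (simp flip: scaleR_left_distrib)
  ultimately show ?thesis
    by (simp add: trilinear scaleR_add_right mult.commute)
qed

text \<open>
  Continuity at the origin together with homogeneity, as for linear maps.
\<close>

lemma bounded_triple:
  obtains K where "0 \<le> K" "\<And>x y z. norm (T x y z) \<le> K * norm x * norm y * norm z"
proof -
  have "isCont (\<lambda>(x, y, z). T x y z) (0, 0, 0)"
    using continuous by (simp add: continuous_on_eq_continuous_at)
  then obtain d where d: "0 < d" "\<And>w. dist w (0, 0, 0) < d \<Longrightarrow>
      dist ((\<lambda>(x, y, z). T x y z) w) ((\<lambda>(x, y, z). T x y z) (0, 0, 0)) < 1"
    unfolding continuous_at_eps_delta by (metis zero_less_one)
  have near: "norm (T x y z) \<le> 1" if "norm x \<le> d / 4" "norm y \<le> d / 4" "norm z \<le> d / 4" for x y z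
  proof -
    have "norm (x, y, z) \<le> norm x + (norm y + norm z)"
      using norm_Pair_le[of x "(y, z)"] norm_Pair_le[of y z] by linarith
    then have "norm (x, y, z) < d"
      using that d(1) by linarith
    then have "dist (x, y, z) (0, 0, 0) < d"
      by (simp add: dist_norm)
    from d(2)[OF this] show ?thesis
      by (simp add: trilinear dist_norm)
  qed
  have "norm (T x y z) \<le> (4 / d) ^ 3 * norm x * norm y * norm z" for x y z
  proof (cases "x = 0 \<or> y = 0 \<or> z = 0")
    case True
    then show ?thesis by (auto simp: trilinear)
  next
    case False
    define s where "s x = d / 4 / norm x" for x :: 'a
    have s: "0 < s x" "norm (s x *\<^sub>R x) \<le> d / 4" if "x \<noteq> 0" for x
      using that d(1) by (simp_all add: s_def)
    have "s x * s y * s z * norm (T x y z) \<le> 1"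
      using near[of "s x *\<^sub>R x" "s y *\<^sub>R y" "s z *\<^sub>R z"] s False
      by (simp add: trilinear abs_of_pos mult_ac less_imp_le)
    then have "norm (T x y z) \<le> 1 / (s x * s y * s z)"
      using s False by (simp add: field_simps)
    also have "\<dots> = (4 / d) ^ 3 * norm x * norm y * norm z"
      using False d(1) by (simp add: s_def power3_eq_cube)
    finally show ?thesis .
  qed
  then show thesis
    using d(1) by (intro that[of "(4 / d) ^ 3"]) simp_all
qed

text \<open>
  An eigenvalue belongs to the spectrum, because a left inverse would have to map 0 to the eigenvector.
\<close>

lemma eigenvalue_nonneg:
  assumes "T a a x = k *\<^sub>C x" "x \<noteq> 0"
  shows "k \<in> \<real>\<^sub>\<ge>\<^sub>0"
proof -
  have "k \<in> spectrum (T a a)"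
  proof (rule ccontr)
    assume "k \<notin> spectrum (T a a)"
    then obtain S where S: "bounded_clinear S" "\<And>x. S (k *\<^sub>C x - T a a x) = x"
      unfolding spectrum_def by blast
    have "S 0 = 0"
      using S(1) by (simp add: bounded_clinear_def linear_simps)
    then show False
      using S(2)[of x] assms by simp
  qed
  then show ?thesis
    using spectrum_nonneg by blast
qed

section \<open>Peirce theory of a tripotent\<close>

lemma tripotent_norm_le:
  assumes "T e e e = e"
  shows "norm e \<le> 1"
proof (rule ccontr)
  assume "\<not> norm e \<le> 1"
  then have "norm e < norm e ^ 3"
    using power_strict_increasing[of 1 3 "norm e"] by simp
  then show False
    using norm_cube[of e] assms by simp
qed

lemma tripotent_norm:
  assumes "T e e e = e" "e \<noteq> 0"
  shows "norm e = 1"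
proof -
  have "norm e * (norm e ^ 2) = norm e * 1"
    using norm_cube[of e] assms(1) by (simp add: power2_eq_square power3_eq_cube)
  then have "norm e ^ 2 = 1"
    using assms(2) by (simp only: mult_cancel_left norm_eq_zero) simp
  then show ?thesis
    using power2_eq_1_iff[of "norm e"] norm_ge_zero[of e] by linarith
qed

text \<open>
  Write \<open>L\<close> for \<open>T e e\<close> and \<open>Q\<close> for the conjugate-linear map \<open>\<lambda>z. T e z e\<close>. The next two lemmas give
  \<open>L Q = Q = Q L\<close> and \<open>Q\<^sup>2 = 2 L\<^sup>2 - L\<close>, on which the Peirce decomposition rests: \<open>Q\<^sup>2\<close> is the
  Peirce 2-projection, and \<open>L Q\<^sup>2 = Q\<^sup>2\<close> is a cubic equation for \<open>L\<close> with the roots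
  0, 1/2 and 1. Here, the Jordan identity applied to \<open>{e,e,{e,z,e}}\<close> and to \<open>{e,z,{e,e,e}}\<close> yields
  \<open>L Q = 2 Q - Q L\<close> and \<open>Q = 2 L Q - Q L\<close>.
\<close>

lemma tripotent_LQ:
  assumes e: "T e e e = e"
  shows "T e e (T e z e) = T e z e" "T e (T e e z) e = T e z e"
proof -
  define a q b where "a = T e e (T e z e)" and "q = T e z e" and "b = T e (T e e z) e"
  have 1: "a = q + q - b"
    using jordan_identity[of e e e z e] by (simp add: e a_def q_def b_def)
  have "T e z e = a + a - b"
    using jordan_identity[of e z e e e]
    by (simp add: e a_def b_def commute[of "T e z e" e e] commute[of z e e])
  then have 2: "q = a + a - b" by (simp add: q_def)
  have "a - q = (q + q - b) - (a + a - b)"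
    using arg_cong2[OF 1 2, of "(-)"] .
  then have "a + a + a = q + q + q"
    by (simp add: algebra_simps)
  moreover have "3 *\<^sub>R x = x + x + x" for x :: 'a
    using scaleR_left_distrib[of 2 1 x] by (simp add: scaleR_2)
  ultimately have "a = q"
    by (metis scaleR_cancel_left zero_neq_numeral)
  moreover from this 1 have "b = q"
    by simp
  ultimately show "T e e (T e z e) = T e z e" "T e (T e e z) e = T e z e"
    by (simp_all add: a_def b_def q_def)
qed

lemma tripotent_QQ:
  assumes e: "T e e e = e"
  shows "T e (T e z e) e = 2 *\<^sub>R T e e (T e e z) - T e e z"
  using jordan_identity[of z e e e e]
  by (simp add: e commute[of z e e] commute[of "T e e z" e e] scaleR_2 algebra_simps)

lemma peirce_eigenvalue:
  assumes e: "T e e e = e" and x: "T e e x = k *\<^sub>C x" "x \<noteq> 0"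
  shows "k = 0 \<or> k = 1 / 2 \<or> k = 1"
proof -
  have QQ: "T e (T e x e) e = (2 * k * k - k) *\<^sub>C x"
    using scaleC_of_real[of 2 "T e e (T e e x)"]
    by (simp add: tripotent_QQ[OF e] x trilinear scaleC_scaleC mult.assoc
        complex_vector.scale_left_diff_distrib)
  have "((2 * k * k - k) * k) *\<^sub>C x = (2 * k * k - k) *\<^sub>C x"
    using tripotent_LQ(1)[OF e, of "T e x e"] unfolding QQ
    by (simp add: trilinear x scaleC_scaleC)
  then have "(2 * k * k - k) * k = 2 * k * k - k"
    using x(2) by simp
  then have "k * (2 * k - 1) * (k - 1) = 0"
    by (simp add: algebra_simps)
  then have "k = 0 \<or> 2 * k = 1 \<or> k = 1"
    by simp
  then show ?thesis
    by (auto simp: field_simps)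
qed

lemma peirce_grading:
  assumes "T v v x = i *\<^sub>R x" "T v v y = j *\<^sub>R y" "T v v z = k *\<^sub>R z"
  shows "T v v (T x y z) = (i - j + k) *\<^sub>R T x y z"
  using jordan_identity[of v v x y z]
  by (simp add: assms trilinear scaleR_left_distrib scaleR_left_diff_distrib)

text \<open>
  The operators \<open>D1 = L v x\<close> and \<open>D2 = L x v\<close> (in the notation \<open>L a b z = T a b z\<close>) vanish because their
  commutators with \<open>L v v\<close> can be computed in two ways by the Jordan identity; one result is 0, and
  the other one is \<open>D1\<close> or \<open>- D2\<close>. This uses \<open>{v,x,v} = 0\<close>, which is \<open>Q = Q L\<close> at \<open>x\<close>.
\<close>

lemma peirce0_orthogonal:
  assumes v: "T v v v = v" and x: "T v v x = 0"
  shows "T v x v = 0" "T v x z = 0" "T x v z = 0" "T z x v = 0" "T z v x = 0"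
proof -
  show Q: "T v x v = 0"
    using tripotent_LQ(2)[OF v, of x] by (simp add: x trilinear)
  have x': "T x v v = 0"
    using x by (simp add: commute[of x])
  show 1: "T v x z = 0" for z
    using jordan_identity[of v v v x z] jordan_identity[of v x v v z]
    by (simp add: v x x' Q trilinear)
  show 2: "T x v z = 0" for z
    using jordan_identity[of v v x v z] jordan_identity[of x v v v z]
    by (simp add: v x x' Q trilinear)
  show "T z x v = 0" "T z v x = 0"
    using 1[of z] 2[of z] by (simp_all add: commute[of z])
qed

lemma peirce1_compression:
  assumes v: "T v v v = v" and x: "T v v x = (1/2) *\<^sub>R x"
  shows "T v x v = 0"
proof -
  have "(1/2) *\<^sub>R T v x v = 1 *\<^sub>R T v x v"
    using tripotent_LQ(2)[OF v, of x] by (simp add: x trilinear)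
  then show ?thesis
    by (simp only: scaleR_cancel_right) simp
qed

text \<open>
  The image of \<open>Q\<close> is the Peirce 2-space, by \<open>L Q = Q\<close> and because \<open>Q\<^sup>2 x = x\<close> for every \<open>x\<close> in that
  space. Minimality is used below in this form.
\<close>

lemma minimal_tripotent_iff:
  "w \<in> minimal_tripotents T \<longleftrightarrow> T w w w = w \<and> w \<noteq> 0 \<and> (\<forall>x. \<exists>k. T w x w = k *\<^sub>C w)"
proof -
  have "peirce_space T 2 w = range (\<lambda>c. c *\<^sub>C w) \<longleftrightarrow> (\<forall>x. \<exists>k. T w x w = k *\<^sub>C w)"
    if w: "T w w w = w"
  proof
    assume eq: "peirce_space T 2 w = range (\<lambda>c. c *\<^sub>C w)"
    have "T w x w \<in> peirce_space T 2 w" for x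
      by (simp add: peirce_space_def tripotent_LQ[OF w])
    then show "\<forall>x. \<exists>k. T w x w = k *\<^sub>C w"
      unfolding eq by blast
  next
    assume compress: "\<forall>x. \<exists>k. T w x w = k *\<^sub>C w"
    have "x \<in> range (\<lambda>c. c *\<^sub>C w)" if "T w w x = x" for x
    proof -
      have "x = T w (T w x w) w"
        by (simp add: tripotent_QQ[OF w] that scaleR_2)
      then show ?thesis
        using compress by (metis rangeI)
    qed
    then show "peirce_space T 2 w = range (\<lambda>c. c *\<^sub>C w)"
      by (auto simp: peirce_space_def w trilinear)
  qed
  then show ?thesis
    by (auto simp: minimal_tripotents_def tripotents_def)
qed

lemma minimal_peirce2:
  assumes v: "v \<in> minimal_tripotents T" and x: "T v v x = x"
  obtains k where "x = k *\<^sub>C v"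
proof -
  have "x \<in> peirce_space T 2 v"
    using x by (simp add: peirce_space_def)
  then show thesis
    using v that by (auto simp: minimal_tripotents_def)
qed

text \<open>
  The components are the values at \<open>x\<close> of the polynomials \<open>2 L\<^sup>2 - L = Q\<^sup>2\<close>, \<open>4 L - 4 L\<^sup>2\<close> and
  \<open>1 - 3 L + 2 L\<^sup>2\<close>, the Lagrange polynomials for the eigenvalues 1, 1/2 and 0.
\<close>

lemma peirce_decomposition:
  assumes v: "T v v v = v"
  obtains x1 x0 where "x = T v (T v x v) v + x1 + x0"
    "T v v x1 = (1/2) *\<^sub>R x1" "T v v x0 = 0"
proof -
  define a b c where "a = T v v x" and "b = T v v a" and "c = T v v b"
  have L2: "T v (T v x v) v = 2 *\<^sub>R b - a"
    by (simp add: tripotent_QQ[OF v] a_def b_def)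
  have "2 *\<^sub>R c - b = 2 *\<^sub>R b - a"
    using tripotent_LQ(1)[OF v, of "T v x v"] unfolding L2 
    by (simp add: trilinear flip: b_def c_def)
  then have "2 *\<^sub>R c = 3 *\<^sub>R b - a"
    by (simp add: algebra_simps) (metis add.commute numeral_plus_one scaleR_add_left scaleR_one semiring_norm(5))
  then have "(1/2) *\<^sub>R 2 *\<^sub>R c = (1/2) *\<^sub>R (3 *\<^sub>R b - a)"
    by simp
  then have c: "c = (3/2) *\<^sub>R b - (1/2) *\<^sub>R a"
    by (simp add: scaleR_diff_right)
  have La: "T v v a = b" and Lb: "T v v b = c" and Lx: "T v v x = a"
    by (simp_all add: a_def b_def c_def)
  show thesis
  proof
    show "x = T v (T v x v) v + (4 *\<^sub>R a - 4 *\<^sub>R b) + (x - 3 *\<^sub>R a + 2 *\<^sub>R b)"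
      using scaleR_left_distrib[of 3 1 a] scaleR_left_distrib[of 2 2 b]
      by (simp add: L2 algebra_simps)
    show "T v v (4 *\<^sub>R a - 4 *\<^sub>R b) = (1/2) *\<^sub>R (4 *\<^sub>R a - 4 *\<^sub>R b)"
      using scaleR_left_distrib[of 4 2 b]
      by (simp add: trilinear La Lb c algebra_simps)
    show "T v v (x - 3 *\<^sub>R a + 2 *\<^sub>R b) = 0"
      using scaleR_left_distrib[of 2 1 a] scaleR_left_distrib[of 2 1 b]
      by (simp add: trilinear La Lb Lx c algebra_simps)
  qed
qed

section \<open>A minimal tripotent that detects the lack of orthogonality\<close>

text \<open>
  The model case is that of rank-one matrices: for the matrix units \<open>v = E11\<close> and \<open>u = E12\<close> and for
  \<open>e = r u + e0\<close> with \<open>e0\<close> in the second row, the witness is a unit row vector \<open>w\<close> in the plane of \<open>v\<close>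
  and \<open>u\<close>. In a general triple, the relations between \<open>v\<close>, \<open>u\<close> and their Peirce spaces that make this
  \<open>w\<close> a minimal tripotent come from comparing Peirce components (with respect to \<open>v\<close>) on both sides of
  \<open>{e,x,e} = k e\<close>, the minimality of \<open>e\<close>.
\<close>

lemma transition_witness:
  assumes v: "v \<in> minimal_tripotents T" and e: "e \<in> minimal_tripotents T"
    and vev: "T v e v = 0" and eve: "T e v e = 0" and nonorth: "T e e v \<noteq> 0"
  obtains w a b where "w \<in> minimal_tripotents T"
    "T w v w = a *\<^sub>R w" "T w e w = b *\<^sub>R w" "1 < a + b"
proof -
  have v3: "T v v v = v" and e3: "T e e e = e"
    using v e by (auto simp: minimal_tripotent_iff)
  note orth = peirce0_orthogonal[OF v3]
  obtain e1 e0 where dec: "e = e1 + e0" and L1: "T v v e1 = (1/2) *\<^sub>R e1" and L0: "T v v e0 = 0"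
    using peirce_decomposition[OF v3, of e] vev by (auto simp: trilinear)
  have e1_nz: "e1 \<noteq> 0"
    using nonorth orth(4)[of e e] dec L0 by auto
  have e1v: "T e1 v e1 = 0"
    using eve orth[OF L0] by (simp add: dec trilinear)
  have compress: "\<exists>k. T e1 x e1 + (2 *\<^sub>R T e1 x e0 + T e0 x e0) = k *\<^sub>C e1 + k *\<^sub>C e0" for x
  proof -
    obtain k where "T e x e = k *\<^sub>C e"
      using e by (auto simp: minimal_tripotent_iff)
    then have "T e1 x e1 + (2 *\<^sub>R T e1 x e0 + T e0 x e0) = k *\<^sub>C e1 + k *\<^sub>C e0"
      using quadratic_expand[of 1 e1 1 e0 x] by (simp add: dec scaleC_add_right add.assoc)
    then show ?thesis by blast
  qed

  \<comment> \<open>The Peirce 1-component of \<open>{e,e1,e} = k e\<close> makes \<open>e1\<close> a multiple of a tripotent.\<close>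
  obtain g where g: "0 < g" "T e1 e1 e1 = g *\<^sub>R e1"
  proof -
    obtain k where k: "T e1 e1 e1 + (2 *\<^sub>R T e1 e1 e0 + T e0 e1 e0) = k *\<^sub>C e1 + k *\<^sub>C e0"
      using compress by blast
    have 1: "T v v (T e1 e1 e1) = (1/2) *\<^sub>R T e1 e1 e1"
      using peirce_grading[OF L1 L1 L1] by simp
    have 0: "T v v (T e1 e1 e0) = 0"
      using peirce_grading[OF L1 L1, of e0 0] L0 by simp
    have "T v v (T e0 e1 e0) = (- (1/2)) *\<^sub>R T e0 e1 e0"
      using peirce_grading[OF _ L1, of e0 0 e0 0] L0 by simp
    then have "T v v (T e0 e1 e0) = complex_of_real (- (1/2)) *\<^sub>C T e0 e1 e0"
      by (simp only: scaleC_of_real)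
    from peirce_eigenvalue[OF v3 this] have m: "T e0 e1 e0 = 0"
      by (cases "T e0 e1 e0 = 0") (auto simp: complex_eq_iff)
    have "(1/2) *\<^sub>R T e1 e1 e1 = (1/2) *\<^sub>R (k *\<^sub>C e1)"
      using arg_cong[OF k, of "T v v"]
      by (simp add: trilinear 1 0 m L1 L0) (simp add: scaleC_scaleC mult.commute flip: scaleC_of_real)
    then have eig: "T e1 e1 e1 = k *\<^sub>C e1"
      by simp
    then obtain g where g: "k = complex_of_real g" "0 \<le> g"
      using eigenvalue_nonneg[OF eig e1_nz] by (auto elim: nonneg_Reals_cases)
    have "g \<noteq> 0"
      using norm_cube[of e1] eig e1_nz g by auto
    then have "0 < g"
      using g by simp
    moreover have "T e1 e1 e1 = g *\<^sub>R e1"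
      using eig by (simp add: g scaleC_of_real)
    ultimately show thesis
      by (rule that)
  qed

  define r where "r = sqrt g"
  have r: "0 < r" "r * r = g"
    using g by (auto simp: r_def)
  define u where "u = (1 / r) *\<^sub>R e1"
  have e1_u: "e1 = r *\<^sub>R u" and u_nz: "u \<noteq> 0"
    using r e1_nz by (auto simp: u_def)
  have u3: "T u u u = u"
    using r g by (simp add: u_def trilinear flip: r(2))
  have Lu: "T v v u = (1/2) *\<^sub>R u"
    by (simp add: u_def trilinear L1)
  have uvu: "T u v u = 0"
    by (simp add: u_def trilinear e1v)
  have vuv: "T v u v = 0"
    using peirce1_compression[OF v3 Lu] .
  have uvv: "T u v v = (1/2) *\<^sub>R u"
    using Lu by (simp add: commute[of u])

  \<comment> \<open>The minimality of \<open>v\<close> makes \<open>v\<close> an eigenvector of \<open>L u u\<close>. Eigenvalue 0 would make \<open>u\<close> and \<open>v\<close>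
    orthogonal, and eigenvalue 1 is excluded by \<open>{u,v,u} = 0\<close>.\<close>
  have uuv: "T u u v = (1/2) *\<^sub>R v"
  proof -
    have "T v v (T u u v) = T u u v"
      using peirce_grading[OF Lu Lu, of v 1] v3 by simp
    then obtain l where l: "T u u v = l *\<^sub>C v"
      using minimal_peirce2[OF v] by blast
    have v_nz: "v \<noteq> 0"
      using v by (simp add: minimal_tripotent_iff)
    have "l \<noteq> 0"
    proof
      assume "l = 0"
      then have "T u v v = 0"
        using l peirce0_orthogonal(2)[OF u3, of v v] by simp
      then show False
        using uvv u_nz by simp
    qed
    moreover have "l \<noteq> 1"
    proof
      assume "l = 1"
      then have "T u u v = v"
        using l by (simp add: scaleC_one)
      then show False
        using tripotent_QQ[OF u3, of v] uvu v_nz by (simp add: trilinear scaleR_2)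
    qed
    ultimately have half: "l = 1 / 2"
      using peirce_eigenvalue[OF u3 l v_nz] by simp
    show ?thesis
      unfolding l half using scaleC_of_real[of "1/2" v] by simp
  qed
  have vuu: "T v u u = (1/2) *\<^sub>R v"
    using uuv by (simp add: commute[of v])

  \<comment> \<open>The Peirce 2-component of \<open>{e,x,e} = k e\<close> is \<open>{e1,x,e1}\<close> on the left and 0 on the right.\<close>
  have compress0: "T u x u = 0" if x: "T v v x = 0" for x
  proof -
    have Le: "T v v e0 = 0 *\<^sub>R e0" and Lx: "T v v x = 0 *\<^sub>R x"
      using L0 x by simp_all
    obtain k where k: "T e1 x e1 + (2 *\<^sub>R T e1 x e0 + T e0 x e0) = k *\<^sub>C e1 + k *\<^sub>C e0"
      using compress by blast
    have 2: "T v v (T e1 x e1) = T e1 x e1"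
      using peirce_grading[OF L1 Lx L1] by simp
    have 1: "T v v (T e1 x e0) = (1/2) *\<^sub>R T e1 x e0"
      using peirce_grading[OF L1 Lx Le] by simp
    have 0: "T v v (T e0 x e0) = 0"
      using peirce_grading[OF Le Lx Le] by simp
    have k1: "T e1 x e1 + T e1 x e0 = (1/2) *\<^sub>R (k *\<^sub>C e1)"
      using arg_cong[OF k, of "T v v"]
      by (simp add: trilinear 2 1 0 L1 L0) (simp add: scaleC_scaleC mult.commute flip: scaleC_of_real)
    have "T e1 x e1 + (1/2) *\<^sub>R T e1 x e0 = (1/2) *\<^sub>R (1/2) *\<^sub>R (k *\<^sub>C e1)"
      using arg_cong[OF k1, of "T v v"]
      by (simp add: trilinear 2 1 0 L1 L0) (simp add: scaleC_scaleC mult.commute flip: scaleC_of_real)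
    then have "1 *\<^sub>R T e1 x e1 = (1/2) *\<^sub>R T e1 x e1"
      unfolding k1[symmetric] by (simp add: scaleR_add_right)
    then have "T e1 x e1 = 0"
      by (simp only: scaleR_cancel_right) simp
    then show ?thesis
      by (simp add: u_def trilinear)
  qed

  \<comment> \<open>On the Peirce 1-space of \<open>v\<close>, \<open>{x,y,v} = \<langle>x,y\<rangle> v\<close> defines a sesquilinear form. The first use of the
    Jordan identity shows that it is hermitian, the second one expresses \<open>{u,x,u}\<close> through it.\<close>
  have compress1: "\<exists>k. T v x u = k *\<^sub>C v \<and> T u x u = 2 *\<^sub>R k *\<^sub>C u"
    if x: "T v v x = (1/2) *\<^sub>R x" for x
  proof -
    have Lv: "T v v v = 1 *\<^sub>R v"
      using v3 by simp
    have "T v v (T v x u) = T v x u" "T v v (T v u x) = T v u x"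
      using peirce_grading[OF Lv x Lu] peirce_grading[OF Lv Lu x] by simp_all
    then obtain k l where k: "T v x u = k *\<^sub>C v" and l: "T v u x = l *\<^sub>C v"
      using minimal_peirce2[OF v] by metis
    have "l *\<^sub>C v = l *\<^sub>C v + l *\<^sub>C v - cnj k *\<^sub>C v"
      using jordan_identity[of x u v v v]
      by (simp add: v3 commute[of x u v] commute[of u x v] k l trilinear)
    then have "l = cnj k"
      using v by (simp add: minimal_tripotent_iff)
    then have "(1/2) *\<^sub>R k *\<^sub>C u = (1/2) *\<^sub>R T u x u - (1/2) *\<^sub>R k *\<^sub>C u"
      using jordan_identity[of u v v x u]
      by (simp add: uvv uvu k l Lu trilinear) (simp add: scaleC_scaleC mult.commute flip: scaleC_of_real)
    then have "(1/2) *\<^sub>R T u x u = (1/2) *\<^sub>R k *\<^sub>C u + (1/2) *\<^sub>R k *\<^sub>C u"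
      by (simp add: algebra_simps)
    also have "\<dots> = k *\<^sub>C u"
      by (simp flip: scaleR_left_distrib)
    finally have "2 *\<^sub>R ((1/2) *\<^sub>R T u x u) = 2 *\<^sub>R k *\<^sub>C u"
      by (simp only:)
    then have "T u x u = 2 *\<^sub>R k *\<^sub>C u"
      by simp
    then show ?thesis
      using k by blast
  qed

  \<comment> \<open>The rational parametrization of the circle, at the parameter \<open>r/2\<close>: with parameter \<open>t\<close>, the
    condition \<open>1 < c + r s\<close> reads \<open>0 < t < r\<close>.\<close>
  define c where "c = (1 - (r/2)\<^sup>2) / (1 + (r/2)\<^sup>2)"
  define s where "s = r / (1 + (r/2)\<^sup>2)"
  define w where "w = c *\<^sub>R v + s *\<^sub>R u"
  have cs: "c * c + s * s = 1" "1 < c + r * s"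
  proof -
    have pos: "0 < 1 + (r/2)\<^sup>2"
      by (simp add: add_pos_nonneg)
    have "c * c + s * s = ((1 - (r/2)\<^sup>2)\<^sup>2 + r\<^sup>2) / (1 + (r/2)\<^sup>2)\<^sup>2"
      by (simp add: c_def s_def add_divide_distrib power2_eq_square)
    also have "(1 - (r/2)\<^sup>2)\<^sup>2 + r\<^sup>2 = (1 + (r/2)\<^sup>2)\<^sup>2"
      by (simp add: power2_eq_square algebra_simps)
    finally show "c * c + s * s = 1"
      using pos by simp
    have "c + r * s = (1 - (r/2)\<^sup>2 + r\<^sup>2) / (1 + (r/2)\<^sup>2)"
      unfolding c_def s_def by (simp only: add_divide_distrib power2_eq_square times_divide_eq_right)
    moreover have "1 + (r/2)\<^sup>2 < 1 - (r/2)\<^sup>2 + r\<^sup>2"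
      using r(1) by (simp add: power2_eq_square)
    ultimately show "1 < c + r * s"
      using pos by (simp add: less_divide_eq)
  qed
  have s_pos: "0 < s"
    using r(1) by (simp add: s_def add_pos_nonneg)
  have wxw: "T w x w = (c * c) *\<^sub>R T v x v + (2 * c * s) *\<^sub>R T v x u + (s * s) *\<^sub>R T u x u" for x
    unfolding w_def by (rule quadratic_expand)
  have wvw: "T w v w = c *\<^sub>R w"
    by (simp add: wxw v3 Lu uvu) (simp add: w_def scaleR_add_right)
  have wuw: "T w u w = s *\<^sub>R w"
    by (simp add: wxw vuv vuu u3) (simp add: w_def scaleR_add_right mult.commute)
  have "T w w w = c *\<^sub>R T w v w + s *\<^sub>R T w u w"
    by (subst (2) w_def) (simp add: trilinear)
  also have "\<dots> = (c * c + s * s) *\<^sub>R w"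
    by (simp add: wvw wuw scaleR_left_distrib)
  finally have w3: "T w w w = w"
    by (simp add: cs)
  have "w \<noteq> 0"
  proof
    assume w0: "w = 0"
    have "T v w v = c *\<^sub>R v"
      by (simp add: w_def trilinear v3 vuv)
    then have "c *\<^sub>R v = 0"
      using w0 by (simp add: trilinear)
    then show False
      using w0 s_pos u_nz by (auto simp: w_def)
  qed
  moreover have "\<exists>k. T w x w = k *\<^sub>C w" for x
  proof -
    obtain x1 x0 where x: "x = T v (T v x v) v + x1 + x0"
      "T v v x1 = (1/2) *\<^sub>R x1" "T v v x0 = 0"
      using peirce_decomposition[OF v3, of x] by blast
    obtain l where l: "T v (T v x v) v = l *\<^sub>C v"
      using v by (auto simp: minimal_tripotent_iff)
    obtain k where k: "T v x1 u = k *\<^sub>C v" "T u x1 u = 2 *\<^sub>R k *\<^sub>C u"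
      using compress1[OF x(2)] by blast
    have "T v x1 v = 0"
      using peirce1_compression[OF v3 x(2)] .
    then have x1: "T w x1 w = (2 * s) *\<^sub>R k *\<^sub>C w"
      unfolding wxw k
      by (simp add: w_def scaleC_add_right scaleR_add_right)
        (simp add: scaleC_scaleC mult_ac flip: scaleC_of_real)
    have x0: "T w x0 w = 0"
      by (simp add: wxw orth[OF x(3)] compress0[OF x(3)])
    have "T w x w = T w (l *\<^sub>C v) w + T w x1 w + T w x0 w"
      unfolding l[symmetric] by (subst x(1)) (simp add: trilinear)
    also have "\<dots> = (cnj l * of_real c + of_real (2 * s) * k) *\<^sub>C w"
      by (simp add: x1 x0 trilinear wvw scaleC_add_left flip: scaleC_of_real scaleC_scaleC)
    finally show ?thesis by blast
  qed
  ultimately have w: "w \<in> minimal_tripotents T"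
    using w3 by (simp add: minimal_tripotent_iff)
  have "T w e w = (r * s) *\<^sub>R w"
    using orth[OF L0] compress0[OF L0]
    by (simp add: dec e1_u trilinear wuw) (simp add: wxw)
  then show thesis
    by (rule that[OF w wvw _ cs(2)])
qed

section \<open>The norm near a tripotent\<close>

text \<open>
  If \<open>{w,y,w} = 0\<close>, then up to terms of second order in \<open>y\<close> the cube of \<open>w + y\<close> is \<open>w + z\<close> with \<open>z = 2 {w,w,y}\<close>, the
  Peirce 1-component of \<open>y\<close>. For \<open>y = z\<close> this reads \<open>n\<^sup>3 \<le> n + O((norm z)\<^sup>2)\<close> with \<open>n = norm (w + z)\<close>,
  which forces \<open>n \<le> 1 + O((norm z)\<^sup>2)\<close>. In general, it bounds \<open>norm (w + y) ^ 3\<close> by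
  \<open>norm (w + z)\<close> up to second order, and \<open>n\<^sup>3 \<le> m\<close> with \<open>m \<ge> 1\<close> implies \<open>n \<le> m\<close>.
\<close>

lemma norm_near_tripotent:
  assumes w: "T w w w = w"
  obtains C where "0 \<le> C"
    "\<And>y. T w y w = 0 \<Longrightarrow> norm y \<le> 1 \<Longrightarrow> norm (w + y) \<le> 1 + C * (norm y)\<^sup>2"
proof -
  obtain K where K: "0 \<le> K" "\<And>x y z. norm (T x y z) \<le> K * norm x * norm y * norm z"
    using bounded_triple by blast
  define R where "R y = 2 *\<^sub>R T y y w + T y w y + T y y y" for y
  have bound_w: "norm w \<le> 1"
    using tripotent_norm_le[OF w] .
  have R: "norm (R y) \<le> 3 * K * (norm y)\<^sup>2 + K * norm y ^ 3" for y
  proof -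
    have "K * norm y * norm y * norm w \<le> K * norm y * norm y * 1"
      using K(1) bound_w by (intro mult_left_mono) auto
    then have "norm (T y y w) \<le> K * (norm y)\<^sup>2" "norm (T y w y) \<le> K * (norm y)\<^sup>2"
      using K(2)[of y y w] K(2)[of y w y] by (simp_all add: power2_eq_square mult_ac)
    moreover have "norm (T y y y) \<le> K * norm y ^ 3"
      using K(2)[of y y y] by (simp add: power3_eq_cube mult_ac)
    moreover have "norm (R y) \<le> norm (2 *\<^sub>R T y y w) + norm (T y w y) + norm (T y y y)"
      unfolding R_def by (intro norm_triangle_le add_right_mono norm_triangle_ineq)
    ultimately show ?thesis
      by simp
  qed
  have cube: "norm (w + y) ^ 3 \<le> norm (w + 2 *\<^sub>R T w w y) + (3 * K * (norm y)\<^sup>2 + K * norm y ^ 3)"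
    if "T w y w = 0" for y
  proof -
    have "T (w + y) (w + y) (w + y) = (w + 2 *\<^sub>R T w w y) + R y"
      using that by (simp add: R_def trilinear w commute[of y w w] commute[of w y y] scaleR_2)
    then have "norm (w + y) ^ 3 = norm ((w + 2 *\<^sub>R T w w y) + R y)"
      by (simp flip: norm_cube)
    also have "\<dots> \<le> norm (w + 2 *\<^sub>R T w w y) + norm (R y)"
      by (rule norm_triangle_ineq)
    finally show ?thesis
      using R[of y] by simp
  qed
  have fixpoint: "n \<le> 1 + a" if "n ^ 3 \<le> n + a" "0 \<le> a" for n a :: real
  proof (rule ccontr)
    assume "\<not> n \<le> 1 + a"
    then have n: "1 + a < n" "1 < n"
      using that by simp_all
    then have "1 * (n - 1) \<le> (n * (n + 1)) * (n - 1)"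
      by (intro mult_right_mono) (simp_all add: less_1_mult less_imp_le add_strict_increasing2)
    then have "n - 1 \<le> n ^ 3 - n"
      by (simp add: power3_eq_cube algebra_simps)
    with n that show False by simp
  qed
  have root: "n \<le> m" if "n ^ 3 \<le> m" "1 \<le> m" for n m :: real
    using that power_increasing[of 1 3 n] by (cases "1 \<le> n") auto
  show thesis
  proof
    show "0 \<le> 4 * K + (12 * K ^ 3 + 8 * K ^ 4)"
      using K(1) by simp
    fix y
    assume y: "T w y w = 0" "norm y \<le> 1"
    define z where "z = 2 *\<^sub>R T w w y"
    have z: "2 *\<^sub>R T w w z = z" "T w z w = 0"
    proof -
      show "T w z w = 0"
        by (simp add: z_def trilinear tripotent_LQ[OF w] y)
      have "2 *\<^sub>R T w w (T w w y) = T w w y"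
        using tripotent_QQ[OF w, of y] y by (simp add: trilinear)
      then show "2 *\<^sub>R T w w z = z"
        by (simp add: z_def trilinear)
    qed
    have "K * norm w * norm w \<le> K * 1 * 1"
      using K(1) bound_w by (intro mult_mono) auto
    then have "K * norm w * norm w * norm y \<le> K * 1 * 1 * norm y"
      by (intro mult_right_mono) auto
    then have "norm z \<le> 2 * K * norm y"
      using K(2)[of w w y] by (simp add: z_def)
    then have "(norm z)\<^sup>2 \<le> (2 * K * norm y)\<^sup>2" "norm z ^ 3 \<le> (2 * K * norm y) ^ 3"
      by (intro power_mono norm_ge_zero; assumption)+
    then have zs: "(norm z)\<^sup>2 \<le> 4 * K\<^sup>2 * (norm y)\<^sup>2" "norm z ^ 3 \<le> 8 * K ^ 3 * norm y ^ 3"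
      by (simp_all add: power_mult_distrib)
    have y3: "norm y ^ 3 \<le> (norm y)\<^sup>2"
      using y(2) by (intro power_decreasing) auto
    have "norm z ^ 3 \<le> 8 * K ^ 3 * (norm y)\<^sup>2"
      using zs(2) mult_left_mono[OF y3, of "8 * K ^ 3"] K(1) by simp
    then have "3 * K * (norm z)\<^sup>2 + K * norm z ^ 3 \<le>
        3 * K * (4 * K\<^sup>2 * (norm y)\<^sup>2) + K * (8 * K ^ 3 * (norm y)\<^sup>2)"
      using zs(1) K(1) by (intro add_mono mult_left_mono) auto
    also have "\<dots> = (12 * K ^ 3 + 8 * K ^ 4) * (norm y)\<^sup>2"
      by (simp add: power2_eq_square power3_eq_cube power4_eq_xxxx algebra_simps)
    finally have "norm (w + z) ^ 3 \<le> norm (w + z) + (12 * K ^ 3 + 8 * K ^ 4) * (norm y)\<^sup>2"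
      using cube[OF z(2)] z(1) by simp
    then have wz: "norm (w + z) \<le> 1 + (12 * K ^ 3 + 8 * K ^ 4) * (norm y)\<^sup>2"
      by (rule fixpoint) (simp add: K(1))
    have "K * norm y ^ 3 \<le> K * (norm y)\<^sup>2"
      using y3 K(1) by (rule mult_left_mono)
    then have "norm (w + y) ^ 3 \<le> 1 + (4 * K + (12 * K ^ 3 + 8 * K ^ 4)) * (norm y)\<^sup>2"
      using cube[OF y(1)] wz unfolding z_def[symmetric] by (simp add: algebra_simps)
    then show "norm (w + y) \<le> 1 + (4 * K + (12 * K ^ 3 + 8 * K ^ 4)) * (norm y)\<^sup>2"
      by (rule root) (simp add: K(1))
  qed
qed

text \<open>
  A functional \<open>f\<close> in the unit ball whose value at \<open>w\<close> is within \<open>\<epsilon>\<^sup>2\<close> of 1 satisfies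
  \<open>cmod (f y) \<le> (1 + C) \<epsilon> norm y\<close> whenever \<open>{w,y,w} = 0\<close>: evaluate \<open>f\<close> at \<open>w + b y\<close>, where \<open>b y\<close> has norm \<open>\<epsilon>\<close> and
  \<open>f (b y)\<close> is non-negative. For arbitrary \<open>x\<close>, the difference \<open>x - k w\<close> is such an element \<open>y\<close>. The constant \<open>D\<close> depends on \<open>w\<close> only, which is what turns
  the estimate into norm convergence later on.
\<close>

lemma functional_near_minimal:
  assumes w: "T w w w = w" "w \<noteq> 0"
  obtains D where "0 \<le> D"
    "\<And>f \<epsilon> x k. \<lbrakk>\<And>x y. f (x + y) = f x + f y; \<And>c x. f (c *\<^sub>C x) = c * f x;
      \<And>x. cmod (f x) \<le> norm x; 0 < \<epsilon>; \<epsilon> \<le> 1; cmod (f w - 1) \<le> \<epsilon>\<^sup>2; T w x w = cnj k *\<^sub>C w\<rbrakk>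
      \<Longrightarrow> cmod (f x - k) \<le> D * \<epsilon> * norm x"
proof -
  obtain K where K: "0 \<le> K" "\<And>x y z. norm (T x y z) \<le> K * norm x * norm y * norm z"
    using bounded_triple by blast
  obtain C where C: "0 \<le> C"
    "\<And>y. T w y w = 0 \<Longrightarrow> norm y \<le> 1 \<Longrightarrow> norm (w + y) \<le> 1 + C * (norm y)\<^sup>2"
    using norm_near_tripotent[OF w(1)] by blast
  have norm_w: "norm w = 1"
    using tripotent_norm[OF w] .
  show thesis
  proof
    show "0 \<le> K + (1 + C) * (1 + K)"
      using K(1) C(1) by simp
    fix f :: "'a \<Rightarrow> complex" and \<epsilon> :: real and x k
    assume add: "\<And>x y. f (x + y) = f x + f y" and scale: "\<And>c x. f (c *\<^sub>C x) = c * f x"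
      and le: "\<And>x. cmod (f x) \<le> norm x" and \<epsilon>: "0 < \<epsilon>" "\<epsilon> \<le> 1"
      and near: "cmod (f w - 1) \<le> \<epsilon>\<^sup>2" and x: "T w x w = cnj k *\<^sub>C w"
    have kernel: "cmod (f y) \<le> (1 + C) * \<epsilon> * norm y" if y: "T w y w = 0" for y
    proof (cases "y = 0")
      case True
      then show ?thesis
        using le[of 0] by simp
    next
      case False
      obtain a where a: "cmod a = 1" "a * f y = complex_of_real (cmod (f y))"
        using phase_exists by blast
      define b where "b = complex_of_real (\<epsilon> / norm y) * a"
      have norm_by: "norm (b *\<^sub>C y) = \<epsilon>"
        using False \<epsilon> by (simp add: b_def norm_scaleC norm_mult a norm_divide)
      have "Re (f w) + \<epsilon> / norm y * cmod (f y) = Re (f (w + b *\<^sub>C y))"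
        by (simp add: add scale b_def mult.assoc a)
      also have "\<dots> \<le> norm (w + b *\<^sub>C y)"
        using complex_Re_le_cmod le order_trans by blast
      also have "\<dots> \<le> 1 + C * \<epsilon>\<^sup>2"
        using C(2)[of "b *\<^sub>C y"] \<epsilon> y norm_by by (simp add: trilinear)
      finally have "\<epsilon> / norm y * cmod (f y) \<le> (1 + C) * \<epsilon>\<^sup>2"
        using near abs_Re_le_cmod[of "f w - 1"] by (simp add: algebra_simps)
      then have "\<epsilon> * cmod (f y) \<le> \<epsilon> * ((1 + C) * \<epsilon> * norm y)"
        using False by (simp add: field_simps power2_eq_square)
      then show ?thesis
        using \<epsilon> by simp
    qed
    define y where "y = x - k *\<^sub>C w"
    have y: "T w y w = 0" and x_split: "x = k *\<^sub>C w + y"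
      by (simp_all add: y_def trilinear x w)
    have k_le: "cmod k \<le> K * norm x"
      using K(2)[of w x w] by (simp add: x norm_scaleC norm_w)
    have y_le: "norm y \<le> (1 + K) * norm x"
      using norm_triangle_ineq4[of x "k *\<^sub>C w"] k_le
      by (simp add: y_def norm_scaleC norm_w algebra_simps)
    have "cmod (f x - k) = cmod (k * (f w - 1) + f y)"
      by (subst x_split) (simp add: add scale algebra_simps)
    also have "\<dots> \<le> cmod k * cmod (f w - 1) + cmod (f y)"
      by (metis norm_mult norm_triangle_ineq)
    also have "\<dots> \<le> (K * norm x) * \<epsilon> + (1 + C) * \<epsilon> * ((1 + K) * norm x)"
    proof (rule add_mono)
      have "\<epsilon>\<^sup>2 \<le> \<epsilon>"
        using \<epsilon> by (simp add: power2_eq_square mult_left_le)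
      then show "cmod k * cmod (f w - 1) \<le> (K * norm x) * \<epsilon>"
        using k_le near K(1) by (intro mult_mono) auto
      show "cmod (f y) \<le> (1 + C) * \<epsilon> * ((1 + K) * norm x)"
        using kernel[OF y] y_le C(1) \<epsilon> by (meson add_nonneg_nonneg less_imp_le mult_left_mono mult_nonneg_nonneg order_trans zero_le_one)
    qed
    finally show "cmod (f x - k) \<le> (K + (1 + C) * (1 + K)) * \<epsilon> * norm x"
      by (simp add: algebra_simps)
  qed
qed

end

section \<open>Support functionals of minimal tripotents\<close>

context jbw_star_triple
begin

lemma J_clinear: "bounded_clinear (blinfun_apply (J x))"
  using J_onto_dual by blast

lemma J_scaleC_predual: "blinfun_apply (J x) (c *\<^sub>C p) = c * blinfun_apply (J x) p"
  using J_clinear[of x] by (simp add: bounded_clinear_def scaleC_complex_def)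

lemma norm_J_le: "cmod (blinfun_apply (J x) p) \<le> norm x * norm p"
  using norm_blinfun[of "J x" p] by (simp add: J_isometric)

lemma predual_norming:
  obtains x where "norm x \<le> 1" "Re (blinfun_apply (J x) p) = norm p"
proof -
  obtain F :: "'p \<Rightarrow>\<^sub>L complex" where F: "bounded_clinear (blinfun_apply F)" "norm F \<le> 1"
      "Re (F p) = norm p"
    using norming_functional[of p] by blast
  then obtain x where "F = J x"
    using J_onto_dual by blast
  with F show thesis
    using J_isometric[of x] that by simp
qed

lemma predual_almost_norming:
  assumes w: "norm w = 1" and \<epsilon>: "0 < \<epsilon>" "\<epsilon> \<le> 1"
  obtains p where "norm p \<le> 1" "cmod (blinfun_apply (J w) p - 1) \<le> \<epsilon>"
proof -
  have "\<exists>p. norm p \<le> 1 \<and> 1 - \<epsilon> < cmod (blinfun_apply (J w) p)"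
  proof (rule ccontr)
    assume "\<not> ?thesis"
    then have small: "cmod (blinfun_apply (J w) p) \<le> 1 - \<epsilon>" if "norm p \<le> 1" for p
      using that by force
    have "norm (J w) \<le> 1 - \<epsilon>"
    proof (rule norm_blinfun_bound)
      fix p
      show "cmod (blinfun_apply (J w) p) \<le> (1 - \<epsilon>) * norm p"
      proof (cases "p = 0")
        case False
        then show ?thesis
          using small[of "p /\<^sub>R norm p"] by (simp add: blinfun.scaleR_right field_simps)
      qed (simp add: blinfun.zero_right)
    qed (use \<epsilon> in simp)
    then show False
      using w \<epsilon> by (simp add: J_isometric)
  qed
  then obtain p where p: "norm p \<le> 1" "1 - \<epsilon> < cmod (blinfun_apply (J w) p)"
    by blast
  obtain a where a: "cmod a = 1"
      "a * blinfun_apply (J w) p = complex_of_real (cmod (blinfun_apply (J w) p))"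
    using phase_exists by blast
  have "cmod (blinfun_apply (J w) p) \<le> 1"
    using norm_J_le[of w p] p w by simp
  moreover have "blinfun_apply (J w) (a *\<^sub>C p) - 1 = complex_of_real (cmod (blinfun_apply (J w) p) - 1)"
    by (simp add: J_scaleC_predual a)
  ultimately have "cmod (blinfun_apply (J w) (a *\<^sub>C p) - 1) \<le> \<epsilon>"
    using p(2) by (simp only: norm_of_real)
  moreover have "norm (a *\<^sub>C p) \<le> 1"
    using p a by (simp add: norm_scaleC)
  ultimately show thesis
    using that by blast
qed

lemma predual_near_minimal:
  assumes w: "w \<in> minimal_tripotents T"
  obtains D where "0 \<le> D"
    "\<And>p \<epsilon> x k. \<lbrakk>norm p \<le> 1; 0 < \<epsilon>; \<epsilon> \<le> 1; cmod (blinfun_apply (J w) p - 1) \<le> \<epsilon>\<^sup>2;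
      T w x w = cnj k *\<^sub>C w\<rbrakk> \<Longrightarrow> cmod (blinfun_apply (J x) p - k) \<le> D * \<epsilon> * norm x"
proof -
  have "T w w w = w" "w \<noteq> 0"
    using w by (auto simp: minimal_tripotent_iff)
  then obtain D where D: "0 \<le> D"
    "\<And>f \<epsilon> x k. \<lbrakk>\<And>x y. f (x + y) = f x + f y; \<And>c x. f (c *\<^sub>C x) = c * f x;
      \<And>x. cmod (f x) \<le> norm x; 0 < \<epsilon>; \<epsilon> \<le> 1; cmod (f w - 1) \<le> \<epsilon>\<^sup>2; T w x w = cnj k *\<^sub>C w\<rbrakk>
      \<Longrightarrow> cmod (f x - k) \<le> D * \<epsilon> * norm x"
    using functional_near_minimal by blast
  show thesis
  proof (rule that[OF D(1)])
    fix p \<epsilon> x k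
    assume p: "norm p \<le> 1" and rest: "0 < \<epsilon>" "\<epsilon> \<le> 1"
      "cmod (blinfun_apply (J w) p - 1) \<le> \<epsilon>\<^sup>2" "T w x w = cnj k *\<^sub>C w"
    have "cmod (blinfun_apply (J z) p) \<le> norm z" for z
      using norm_J_le[of z p] mult_left_le[OF p, of "norm z"] by simp
    then show "cmod (blinfun_apply (J x) p - k) \<le> D * \<epsilon> * norm x"
      using D(2)[of "\<lambda>z. blinfun_apply (J z) p", OF _ _ _ rest]
      by (simp add: J_add blinfun.add_left J_scaleC)
  qed
qed

lemma minimal_norm: "w \<in> minimal_tripotents T \<Longrightarrow> norm w = 1"
  using tripotent_norm[of w] by (simp add: minimal_tripotent_iff)

lemma compression_scalar:
  assumes "w \<in> minimal_tripotents T"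
  obtains k where "T w x w = cnj k *\<^sub>C w"
  using assms that by (metis complex_cnj_cnj minimal_tripotent_iff)

lemma support_compression:
  assumes w: "w \<in> minimal_tripotents T" and p: "norm p \<le> 1" "blinfun_apply (J w) p = 1"
  shows "T w x w = cnj (blinfun_apply (J x) p) *\<^sub>C w"
proof -
  obtain D where D: "0 \<le> D" "\<And>p \<epsilon> x k. \<lbrakk>norm p \<le> 1; 0 < \<epsilon>; \<epsilon> \<le> 1; cmod (blinfun_apply (J w) p - 1) \<le> \<epsilon>\<^sup>2;
      T w x w = cnj k *\<^sub>C w\<rbrakk> \<Longrightarrow> cmod (blinfun_apply (J x) p - k) \<le> D * \<epsilon> * norm x"
    using predual_near_minimal[OF w] by blast
  obtain k where k: "T w x w = cnj k *\<^sub>C w"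
    using compression_scalar[OF w] by blast
  have bound: "cmod (blinfun_apply (J x) p - k) \<le> D * norm x * \<epsilon>" if "0 < \<epsilon>" "\<epsilon> \<le> 1" for \<epsilon>
    using D(2)[OF p(1) that _ k] p(2) by (simp add: mult_ac)
  have "((\<lambda>\<epsilon>. D * norm x * \<epsilon>) \<longlongrightarrow> D * norm x * 0) (at_right 0)"
    by (intro tendsto_intros)
  moreover have "\<forall>\<^sub>F \<epsilon> in at_right 0. cmod (blinfun_apply (J x) p - k) \<le> D * norm x * \<epsilon>"
    using bound by (auto simp: eventually_at_right_field intro!: exI[of _ 1])
  ultimately have "cmod (blinfun_apply (J x) p - k) \<le> D * norm x * 0"
    by (rule tendsto_lowerbound) simp
  then show ?thesis
    using k by simp
qed

text \<open>
  Elements \<open>p n\<close> of the unit ball with \<open>J w (p n)\<close> within \<open>1 / (n + 1)\<^sup>2\<close> of 1 are close to one common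
  functional on the triple, hence close to each other in the predual, which is complete.
\<close>

lemma support_exists:
  assumes w: "w \<in> minimal_tripotents T"
  obtains p where "norm p \<le> 1" "blinfun_apply (J w) p = 1"
proof -
  obtain D where D: "0 \<le> D"
    "\<And>p \<epsilon> x k. \<lbrakk>norm p \<le> 1; 0 < \<epsilon>; \<epsilon> \<le> 1; cmod (blinfun_apply (J w) p - 1) \<le> \<epsilon>\<^sup>2;
      T w x w = cnj k *\<^sub>C w\<rbrakk> \<Longrightarrow> cmod (blinfun_apply (J x) p - k) \<le> D * \<epsilon> * norm x"
    using predual_near_minimal[OF w] by blast
  define \<epsilon> where "\<epsilon> n = inverse (real (Suc n))" for n
  have \<epsilon>: "0 < \<epsilon> n" "\<epsilon> n \<le> 1" for n
    by (simp_all add: \<epsilon>_def field_simps)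
  have \<epsilon>_lim: "\<epsilon> \<longlonglongrightarrow> 0"
    unfolding \<epsilon>_def by (rule LIMSEQ_inverse_real_of_nat)
  have "\<exists>p. norm p \<le> 1 \<and> cmod (blinfun_apply (J w) p - 1) \<le> (\<epsilon> n)\<^sup>2" for n
    using predual_almost_norming[OF minimal_norm[OF w], of "(\<epsilon> n)\<^sup>2"] \<epsilon>[of n]
    by (metis power2_eq_square mult_le_one less_imp_le zero_less_power)
  then obtain p where p: "\<And>n. norm (p n) \<le> 1"
      "\<And>n. cmod (blinfun_apply (J w) (p n) - 1) \<le> (\<epsilon> n)\<^sup>2"
    by metis
  have dist_le: "norm (p m - p n) \<le> D * \<epsilon> m + D * \<epsilon> n" for m n
  proof -
    obtain x where x: "norm x \<le> 1" "Re (blinfun_apply (J x) (p m - p n)) = norm (p m - p n)"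
      using predual_norming by blast
    obtain k where k: "T w x w = cnj k *\<^sub>C w"
      using compression_scalar[OF w] by blast
    have near: "cmod (blinfun_apply (J x) (p i) - k) \<le> D * \<epsilon> i" for i
    proof -
      have "cmod (blinfun_apply (J x) (p i) - k) \<le> D * \<epsilon> i * norm x"
        using D(2)[OF p(1) \<epsilon> p(2) k] .
      also have "\<dots> \<le> D * \<epsilon> i"
        using D(1) \<epsilon>(1)[of i] x(1) by (intro mult_left_le) auto
      finally show ?thesis .
    qed
    have "norm (p m - p n) \<le> cmod (blinfun_apply (J x) (p m - p n))"
      using complex_Re_le_cmod[of "blinfun_apply (J x) (p m - p n)"] x(2) by simp
    also have "\<dots> = cmod ((blinfun_apply (J x) (p m) - k) - (blinfun_apply (J x) (p n) - k))"
      by (simp add: blinfun.diff_right)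
    also have "\<dots> \<le> D * \<epsilon> m + D * \<epsilon> n"
      using near[of m] near[of n] by (meson add_mono norm_triangle_ineq4 order_trans)
    finally show ?thesis .
  qed
  have "Cauchy p"
  proof (rule CauchyI)
    fix e :: real
    assume "0 < e"
    have "(\<lambda>n. D * \<epsilon> n) \<longlonglongrightarrow> D * 0"
      by (intro tendsto_intros \<epsilon>_lim)
    then have "\<forall>\<^sub>F n in sequentially. D * \<epsilon> n < e / 2"
      using \<open>0 < e\<close> by (intro order_tendstoD(2)) auto
    then obtain N where N: "\<And>n. N \<le> n \<Longrightarrow> D * \<epsilon> n < e / 2"
      by (auto simp: eventually_sequentially)
    show "\<exists>M. \<forall>m\<ge>M. \<forall>n\<ge>M. norm (p m - p n) < e"
    proof (intro exI[of _ N] allI impI)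
      fix m n
      assume "N \<le> m" "N \<le> n"
      then show "norm (p m - p n) < e"
        using dist_le[of m n] N[of m] N[of n] by linarith
    qed
  qed
  then obtain q where q: "p \<longlonglongrightarrow> q"
    by (auto simp: Cauchy_convergent_iff convergent_def)
  have "norm q \<le> 1"
    using tendsto_norm[OF q] p(1) by (intro LIMSEQ_le_const2[where a = 1]) auto
  moreover have "blinfun_apply (J w) q = 1"
  proof -
    have "(\<lambda>n. (\<epsilon> n)\<^sup>2) \<longlonglongrightarrow> 0\<^sup>2"
      by (intro tendsto_intros \<epsilon>_lim)
    then have lim: "(\<lambda>n. (\<epsilon> n)\<^sup>2) \<longlonglongrightarrow> 0"
      by simp
    have "(\<lambda>n. blinfun_apply (J w) (p n) - 1) \<longlonglongrightarrow> 0"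
      using p(2) lim by (rule Lim_null_comparison[OF always_eventually[OF allI]])
    then have "(\<lambda>n. blinfun_apply (J w) (p n)) \<longlonglongrightarrow> 1"
      by (rule LIM_zero_cancel)
    moreover have "(\<lambda>n. blinfun_apply (J w) (p n)) \<longlonglongrightarrow> blinfun_apply (J w) q"
      by (intro tendsto_intros q)
    ultimately show ?thesis
      using LIMSEQ_unique by blast
  qed
  ultimately show thesis
    using that by blast
qed

lemma support_unique:
  assumes w: "w \<in> minimal_tripotents T"
    and p: "norm p \<le> 1" "blinfun_apply (J w) p = 1"
    and q: "norm q \<le> 1" "blinfun_apply (J w) q = 1"
  shows "p = q"
proof -
  have "w \<noteq> 0"
    using w by (simp add: minimal_tripotent_iff)
  then have eq: "blinfun_apply (J x) p = blinfun_apply (J x) q" for x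
    using support_compression[OF w p, of x] support_compression[OF w q, of x] by simp
  obtain x where "Re (blinfun_apply (J x) (p - q)) = norm (p - q)"
    using predual_norming by blast
  then show ?thesis
    by (simp add: blinfun.diff_right eq)
qed

text \<open>
  The value 1 at \<open>w\<close> is an extreme point of the unit disc, so both ends of a segment through \<open>p\<close> take
  the value 1 at \<open>w\<close> as well and coincide by uniqueness.
\<close>

lemma support_extreme:
  assumes w: "w \<in> minimal_tripotents T" and p: "norm p \<le> 1" "blinfun_apply (J w) p = 1"
  shows "p extreme_point_of cball 0 1"
  unfolding extreme_point_of_def
proof (intro conjI ballI notI)
  show "p \<in> cball 0 1"
    using p by simp
  fix a b
  assume a: "a \<in> cball 0 1" and b: "b \<in> cball 0 1" and "p \<in> open_segment a b"
  then obtain t where t: "0 < t" "t < 1" "p = (1 - t) *\<^sub>R a + t *\<^sub>R b" and "a \<noteq> b"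
    by (auto simp: in_segment)
  have le: "cmod (blinfun_apply (J w) z) \<le> 1" if "z \<in> cball 0 1" for z
    using norm_J_le[of w z] that minimal_norm[OF w] by simp
  then have re_le: "Re (blinfun_apply (J w) z) \<le> 1" if "z \<in> cball 0 1" for z
    using complex_Re_le_cmod[of "blinfun_apply (J w) z"] that by force
  have sum: "(1 - t) * Re (blinfun_apply (J w) a) + t * Re (blinfun_apply (J w) b) = 1"
    using arg_cong[OF p(2), of Re] by (simp add: t(3) blinfun.add_right blinfun.scaleR_right)
  have one: "z = 1" if "cmod z \<le> 1" "1 \<le> Re z" for z
    using that complex_Re_le_cmod[of z] cmod_power2[of z] power_mono[of "cmod z" 1 2] 
      power_mono[of 1 "Re z" 2] by (simp add: complex_eq_iff) (smt (verit) zero_le_power2 power2_eq_iff_nonneg zero_eq_power2)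
  have "blinfun_apply (J w) a = 1" 
  proof (rule one[OF le[OF a]])
    have "t * Re (blinfun_apply (J w) b) \<le> t * 1"
      using t re_le[OF b] by (intro mult_left_mono) auto
    then have "(1 - t) * 1 \<le> (1 - t) * Re (blinfun_apply (J w) a)"
      using sum by simp
    then show "1 \<le> Re (blinfun_apply (J w) a)"
      using t by (simp only: mult_le_cancel_left_pos)
  qed
  moreover have "blinfun_apply (J w) b = 1"
  proof (rule one[OF le[OF b]])
    have "(1 - t) * Re (blinfun_apply (J w) a) \<le> (1 - t) * 1"
      using t re_le[OF a] by (intro mult_left_mono) auto
    then have "t * 1 \<le> t * Re (blinfun_apply (J w) b)"
      using sum by simp
    then show "1 \<le> Re (blinfun_apply (J w) b)"
      using t by (simp only: mult_le_cancel_left_pos)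
  qed
  ultimately show False
    using support_unique[OF w, of a b] a b \<open>a \<noteq> b\<close> by simp
qed

lemma support_functional:
  assumes w: "w \<in> minimal_tripotents T"
  shows "norm (support_functional J w) \<le> 1"
    and "T w x w = cnj (TTP J x w) *\<^sub>C w"
proof -
  obtain p where p: "norm p \<le> 1" "blinfun_apply (J w) p = 1"
    using support_exists[OF w] by blast
  have "support_functional J w = p"
    unfolding support_functional_def
  proof (rule the_equality)
    show "p extreme_point_of cball 0 1 \<and> blinfun_apply (J w) p = 1"
      using support_extreme[OF w p] p by simp
    show "q = p" if "q extreme_point_of cball 0 1 \<and> blinfun_apply (J w) q = 1" for q
      using that support_unique[OF w _ _ p] by (simp add: extreme_point_of_def)
  qed
  then show "norm (support_functional J w) \<le> 1" "T w x w = cnj (TTP J x w) *\<^sub>C w"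
    using p support_compression[OF w p] by (simp_all add: TTP_def)
qed

lemma TTP_eqI:
  assumes w: "w \<in> minimal_tripotents T" and x: "T w x w = a *\<^sub>R w"
  shows "TTP J x w = complex_of_real a"
proof -
  have "cnj (TTP J x w) *\<^sub>C w = complex_of_real a *\<^sub>C w"
    using support_functional(2)[OF w, of x] x by (simp add: scaleC_of_real)
  then have "cnj (TTP J x w) = complex_of_real a"
    using w by (simp add: minimal_tripotent_iff)
  then show ?thesis
    by (metis complex_cnj_cnj complex_cnj_complex_of_real)
qed

section \<open>Orthogonality in terms of transition pseudo-probabilities\<close>

lemma orthogonal_iff_TTP:
  assumes e: "e \<in> minimal_tripotents T" and v: "v \<in> minimal_tripotents T"
  shows "orthogonal_tripotents T e v \<longleftrightarrow>
    (\<forall>w\<in>minimal_tripotents T. cmod (TTP J e w) + cmod (TTP J v w) \<le> 1)"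
proof
  assume "orthogonal_tripotents T e v"
  then have eev: "T e e v = 0"
    by (simp add: orthogonal_tripotents_def)
  have e3: "T e e e = e" and v3: "T v v v = v"
    using e v by (auto simp: minimal_tripotent_iff)
  note orth = peirce0_orthogonal[OF e3 eev]
  show "\<forall>w\<in>minimal_tripotents T. cmod (TTP J e w) + cmod (TTP J v w) \<le> 1"
  proof
    fix w
    assume w: "w \<in> minimal_tripotents T"
    obtain a where a: "cmod a = 1" "a * TTP J e w = complex_of_real (cmod (TTP J e w))"
      using phase_exists by blast
    obtain b where b: "cmod b = 1" "b * TTP J v w = complex_of_real (cmod (TTP J v w))"
      using phase_exists by blast
    have unit: "c * (cnj c * c) = c" if "cmod c = 1" for c
      using that complex_norm_square[of c] by (simp add: mult_ac)
    define x where "x = a *\<^sub>C e + b *\<^sub>C v"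
    have "T x x x = x"
      using eev orth by (simp add: x_def trilinear e3 v3 scaleC_scaleC unit a(1) b(1))
    then have "norm x \<le> 1"
      by (rule tripotent_norm_le)
    then have "cmod (TTP J x w) \<le> 1"
      using norm_J_le[of x "support_functional J w"] support_functional(1)[OF w]
        mult_mono[of "norm x" 1 "norm (support_functional J w)" 1]
      by (simp add: TTP_def)
    moreover have "TTP J x w = complex_of_real (cmod (TTP J e w) + cmod (TTP J v w))"
      using a(2) b(2) by (simp add: x_def TTP_def J_add J_scaleC blinfun.add_left)
    ultimately show "cmod (TTP J e w) + cmod (TTP J v w) \<le> 1"
      by (simp only: norm_of_real)
  qed
next
  assume le: "\<forall>w\<in>minimal_tripotents T. cmod (TTP J e w) + cmod (TTP J v w) \<le> 1"
  have self: "TTP J w w = 1" if "w \<in> minimal_tripotents T" for w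
    using TTP_eqI[OF that, of w 1] that by (simp add: minimal_tripotent_iff)
  have "TTP J e v = 0" "TTP J v e = 0"
    using le[rule_format, OF v] le[rule_format, OF e] self[OF v] self[OF e] by simp_all
  then have zero: "T v e v = 0" "T e v e = 0"
    using support_functional(2)[OF v, of e] support_functional(2)[OF e, of v] by simp_all
  show "orthogonal_tripotents T e v"
  proof (rule ccontr)
    assume "\<not> orthogonal_tripotents T e v"
    then have "T e e v \<noteq> 0"
      by (simp add: orthogonal_tripotents_def)
    then obtain w a b where w: "w \<in> minimal_tripotents T"
        and ab: "T w v w = a *\<^sub>R w" "T w e w = b *\<^sub>R w" "1 < a + b"
      using transition_witness[OF v e zero] by metis
    have "TTP J v w = complex_of_real a" "TTP J e w = complex_of_real b"
      using TTP_eqI[OF w] ab by simp_all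
    then show False
      using le[rule_format, OF w] ab(3) by simp
  qed
qed

end

theorem theorem3p2:
  fixes T\<^sub>M :: "'m::complex_banach \<Rightarrow> 'm \<Rightarrow> 'm \<Rightarrow> 'm"
    and J\<^sub>M :: "'m \<Rightarrow> 'p::complex_banach \<Rightarrow>\<^sub>L complex"
    and T\<^sub>N :: "'n::complex_banach \<Rightarrow> 'n \<Rightarrow> 'n \<Rightarrow> 'n"
    and J\<^sub>N :: "'n \<Rightarrow> 'q::complex_banach \<Rightarrow>\<^sub>L complex"
    and \<Phi> :: "'m \<Rightarrow> 'n"
  assumes M: "atomic_jbw_star_triple T\<^sub>M J\<^sub>M"
    and N: "atomic_jbw_star_triple T\<^sub>N J\<^sub>N"
    and bij: "bij_betw \<Phi> (minimal_tripotents T\<^sub>M) (minimal_tripotents T\<^sub>N)"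
    and TTP: "\<forall>e\<in>minimal_tripotents T\<^sub>M. \<forall>v\<in>minimal_tripotents T\<^sub>M.
      TTP J\<^sub>N (\<Phi> e) (\<Phi> v) = TTP J\<^sub>M e v"
  shows "\<forall>e\<in>minimal_tripotents T\<^sub>M. \<forall>v\<in>minimal_tripotents T\<^sub>M.
    orthogonal_tripotents T\<^sub>M e v \<longleftrightarrow> orthogonal_tripotents T\<^sub>N (\<Phi> e) (\<Phi> v)"
proof (intro ballI)
  interpret M: atomic_jbw_star_triple T\<^sub>M J\<^sub>M by (rule M)
  interpret N: atomic_jbw_star_triple T\<^sub>N J\<^sub>N by (rule N)
  fix e v
  assume e: "e \<in> minimal_tripotents T\<^sub>M" and v: "v \<in> minimal_tripotents T\<^sub>M"
  have image: "minimal_tripotents T\<^sub>N = \<Phi> ` minimal_tripotents T\<^sub>M"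
    using bij by (simp add: bij_betw_def)
  have "\<Phi> e \<in> minimal_tripotents T\<^sub>N" "\<Phi> v \<in> minimal_tripotents T\<^sub>N"
    using e v by (simp_all add: image)
  then have "orthogonal_tripotents T\<^sub>N (\<Phi> e) (\<Phi> v) \<longleftrightarrow>
      (\<forall>w\<in>minimal_tripotents T\<^sub>M. cmod (TTP J\<^sub>N (\<Phi> e) (\<Phi> w)) + cmod (TTP J\<^sub>N (\<Phi> v) (\<Phi> w)) \<le> 1)"
    by (simp add: N.orthogonal_iff_TTP image)
  then show "orthogonal_tripotents T\<^sub>M e v \<longleftrightarrow> orthogonal_tripotents T\<^sub>N (\<Phi> e) (\<Phi> v)"
    using TTP e v by (simp add: M.orthogonal_iff_TTP)
qed

end
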